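(* Let $X$ be a compact Hausdorff space and $E$ a Banach lattice with order continuous norm. Suppose that $I:C(X)\rightarrow E$ is a comonotonic additive operator with bounded variation. Then there exist two positively homogeneous, translation invariant and monotone operators $I_{1},I_{2}:C(X)\rightarrow E$ such that $I=I_{1}-I_{2}$. Moreover, if $I$ is upper continuous, then both operators $I_{1}$ and $I_{2}$ can be chosen to be upper continuous.
   Context: $C(X)$ is the Banach lattice of real-valued continuous functions on $X$ with pointwise order and sup norm; $1$ is the constant function. A Banach lattice has order continuous norm if every monotone order bounded sequence is norm convergent. Operators $I:C(X)\to E$ are not assumed linear. $I$ is: comonotonic additive if $I(f+g)=I(f)+I(g)$ whenever $f,g$ are comonotone, i.e. $(f(s)-f(t))(g(s)-g(t))\geq0$ for all $s,t\in X$; monotone if $f\leq g$ implies $I(f)\leq I(g)$; positively homogeneous if $I(af)=aI(f)$ for all $a\geq0$; translation invariant if $I(f+c\cdot1)=I(f)+cI(1)$ for all $f\in C(X)$, $c\in\mathbb{R}$; upper continuous if $\lim_n\Vert I(f_n)-I(f)\Vert=0$ for every nonincreasing sequence $(f_n)$ in $C(X)$ converging pointwise to some $f\in C(X)$. $I$ has bounded variation if for all $f\leq g$ in $C(X)$ the supremum $$\vee_{f}^{g}I=\sup\sum_{k=1}^{n}|I(f_{k})-I(f_{k-1})|$$ exists in $E$, the supremum being taken over all finite chains $f=f_{0}\leq f_{1}\leq\cdots\leq f_{n}=g$ in $C(X)$ (here $|\cdot|$ is the modulus in $E$). *)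

theory Defs
  imports "HOL-Analysis.Analysis" "HOL-Library.Lattice_Algebras" "HOL-Library.Lub_Glb"
begin

class banach_lattice = banach + ordered_real_vector + lattice_ab_group_add_abs +
  assumes norm_mono_abs: "\<bar>x\<bar> \<le> \<bar>y\<bar> \<Longrightarrow> norm x \<le> norm y"

definition order_continuous_norm :: "'e::banach_lattice itself \<Rightarrow> bool" where
  "order_continuous_norm _ \<longleftrightarrow>
     (\<forall>u :: nat \<Rightarrow> 'e. monoseq u \<and> (\<exists>a b. \<forall>n. a \<le> u n \<and> u n \<le> b) \<longrightarrow> convergent u)"

text \<open>For compact \<open>X\<close> every continuous real function is bounded, so \<open>C(X)\<close> is the library's
  space of bounded continuous functions \<open>'x \<Rightarrow>\<^sub>C real\<close>, which carries the sup norm.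
  The library does not order it; the order is pointwise.\<close>

instantiation bcontfun :: (topological_space, "{metric_space, order}") order
begin

definition less_eq_bcontfun :: "('a \<Rightarrow>\<^sub>C 'b) \<Rightarrow> ('a \<Rightarrow>\<^sub>C 'b) \<Rightarrow> bool" where
  "f \<le> g \<longleftrightarrow> (\<forall>x. apply_bcontfun f x \<le> apply_bcontfun g x)"

definition less_bcontfun :: "('a \<Rightarrow>\<^sub>C 'b) \<Rightarrow> ('a \<Rightarrow>\<^sub>C 'b) \<Rightarrow> bool" where
  "f < g \<longleftrightarrow> f \<le> g \<and> \<not> g \<le> (f :: 'a \<Rightarrow>\<^sub>C 'b)"

instance
proof
  fix f g :: "'a \<Rightarrow>\<^sub>C 'b"
  assume "f \<le> g" "g \<le> f"
  then show "f = g"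
    by (intro bcontfun_eqI) (simp add: less_eq_bcontfun_def order_antisym)
qed (auto simp: less_eq_bcontfun_def less_bcontfun_def intro: order_trans)

end

definition comonotone :: "('x::topological_space \<Rightarrow>\<^sub>C real) \<Rightarrow> ('x \<Rightarrow>\<^sub>C real) \<Rightarrow> bool" where
  "comonotone f g \<longleftrightarrow> (\<forall>s t. (f s - f t) * (g s - g t) \<ge> 0)"

definition comonotonic_additive ::
    "(('x::topological_space \<Rightarrow>\<^sub>C real) \<Rightarrow> 'e::banach_lattice) \<Rightarrow> bool" where
  "comonotonic_additive I \<longleftrightarrow> (\<forall>f g. comonotone f g \<longrightarrow> I (f + g) = I f + I g)"

definition positively_homogeneous ::
    "(('x::topological_space \<Rightarrow>\<^sub>C real) \<Rightarrow> 'e::banach_lattice) \<Rightarrow> bool" where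
  "positively_homogeneous I \<longleftrightarrow> (\<forall>f. \<forall>a\<ge>0. I (a *\<^sub>R f) = a *\<^sub>R I f)"

definition translation_invariant ::
    "(('x::topological_space \<Rightarrow>\<^sub>C real) \<Rightarrow> 'e::banach_lattice) \<Rightarrow> bool" where
  "translation_invariant I \<longleftrightarrow>
     (\<forall>f c. I (f + c *\<^sub>R const_bcontfun 1) = I f + c *\<^sub>R I (const_bcontfun 1))"

definition upper_continuous ::
    "(('x::topological_space \<Rightarrow>\<^sub>C real) \<Rightarrow> 'e::banach_lattice) \<Rightarrow> bool" where
  "upper_continuous I \<longleftrightarrow>
     (\<forall>F f. decseq F \<and> (\<forall>x. (\<lambda>n. apply_bcontfun (F n) x) \<longlonglongrightarrow> apply_bcontfun f x) \<longrightarrow>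
        (\<lambda>n. norm (I (F n) - I f)) \<longlonglongrightarrow> 0)"

definition variation_sums ::
    "(('x::topological_space \<Rightarrow>\<^sub>C real) \<Rightarrow> 'e::banach_lattice) \<Rightarrow>
      ('x \<Rightarrow>\<^sub>C real) \<Rightarrow> ('x \<Rightarrow>\<^sub>C real) \<Rightarrow> 'e set" where
  "variation_sums I f g =
     {(\<Sum>k = 1..n. \<bar>I (F k) - I (F (k - 1))\<bar>) | (F :: nat \<Rightarrow> 'x \<Rightarrow>\<^sub>C real) n.
        F 0 = f \<and> F n = g \<and> (\<forall>k\<in>{1..n}. F (k - 1) \<le> F k)}"

definition bounded_variation ::
    "(('x::topological_space \<Rightarrow>\<^sub>C real) \<Rightarrow> 'e::banach_lattice) \<Rightarrow> bool" where
  "bounded_variation I \<longleftrightarrow> (\<forall>f g. f \<le> g \<longrightarrow> (\<exists>s. isLub UNIV (variation_sums I f g) s))"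

end

theory Submission
  imports Defs
begin

text \<open>For \<open>f \<ge> 0\<close> let \<open>V f\<close> be the total variation of \<open>I\<close> between \<open>0\<close> and \<open>f\<close>. The splitting
  \<open>f = min f c + (f - c)\<^sup>+\<close> is comonotone, so every chain from \<open>0\<close> to \<open>f + c\<close> splits into a
  chain from \<open>0\<close> to \<open>c\<close> and one from \<open>0\<close> to \<open>f\<close>; hence \<open>V (f + c) = V f + V c\<close>, and \<open>V\<close> extends
  to a translation invariant operator \<open>I\<^sub>1\<close> on all of \<open>C(X)\<close>. One takes \<open>I\<^sub>2 = I\<^sub>1 - I\<close>, which is
  monotone because variation dominates increments. Upper continuity is automatic: by Dini's
  theorem the convergence is uniform, and monotone translation invariant operators are
  Lipschitz.\<close>

section \<open>Constants, truncations and comonotone pairs in \<open>C(X)\<close>\<close>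

lemma scaleR_const_bcontfun_one: "c *\<^sub>R const_bcontfun 1 = (const_bcontfun c :: 'x::topological_space \<Rightarrow>\<^sub>C real)"
  by (rule bcontfun_eqI) simp

definition min_bcontfun :: "('x::topological_space \<Rightarrow>\<^sub>C real) \<Rightarrow> real \<Rightarrow> ('x \<Rightarrow>\<^sub>C real)" where
  "min_bcontfun f c = Bcontfun (\<lambda>x. min (f x) c)"

lemma apply_min_bcontfun: "min_bcontfun f c x = min (f x) c"
proof -
  obtain B where B: "\<And>x. norm (f x) \<le> B"
    using bounded_apply_bcontfun[of f] by (auto simp: bounded_iff)
  have "norm (min (f x) c) \<le> B + \<bar>c\<bar>" for x
    using B[of x] by auto
  then have "bounded (range (\<lambda>x. min (f x) c))"
    by (auto simp: bounded_iff)
  then have "(\<lambda>x. min (f x) c) \<in> bcontfun"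
    by (auto simp: bcontfun_def intro!: continuous_intros)
  then show ?thesis
    by (simp add: min_bcontfun_def Bcontfun_inverse)
qed

text \<open>Adding a large constant makes any function nonnegative, which carries statements about
  nonnegative functions to all of \<open>C(X)\<close>.\<close>

lemma add_const_norm_nonneg:
  fixes f :: "'x::topological_space \<Rightarrow>\<^sub>C real"
  assumes "norm f \<le> c"
  shows "0 \<le> f + const_bcontfun c"
  unfolding less_eq_bcontfun_def
proof
  fix x
  show "apply_bcontfun 0 x \<le> apply_bcontfun (f + const_bcontfun c) x"
    using norm_bounded[of f x] assms by simp
qed

lemma comonotone_const: "comonotone f (const_bcontfun c)"
  by (simp add: comonotone_def)

text \<open>The product of increments is \<open>a * b\<close> times a square. It follows that a
  comonotonic additive operator is additive along each ray.\<close>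

lemma comonotone_scaleR:
  assumes "0 \<le> a" "0 \<le> b"
  shows "comonotone (a *\<^sub>R f) (b *\<^sub>R f)"
proof -
  have "(a * f s - a * f t) * (b * f s - b * f t) = a * b * (f s - f t)\<^sup>2" for s t
    by (simp add: algebra_simps power2_eq_square)
  then show ?thesis
    using assms by (simp add: comonotone_def)
qed

text \<open>Both \<open>min t c\<close> and \<open>t - min t c\<close> are nondecreasing in
  \<open>t\<close>, and nondecreasing functions of one \<open>f\<close> are comonotone.\<close>

lemma comonotone_min_bcontfun: "comonotone (min_bcontfun f c) (f - min_bcontfun f c)"
  by (auto simp: comonotone_def apply_min_bcontfun min_def mult_nonneg_nonneg
      mult_nonpos_nonpos)

section \<open>Dini's theorem and upper continuity\<close>

text \<open>The open sets \<open>U n\<close> on which the error is below \<open>e\<close> grow with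
  \<open>n\<close> and cover the space, so compactness gives one index that serves all
  points.\<close>

lemma Dini_bcontfun:
  fixes F :: "nat \<Rightarrow> ('x::topological_space \<Rightarrow>\<^sub>C real)" and f :: "'x \<Rightarrow>\<^sub>C real"
  assumes "compact (UNIV :: 'x set)" and "decseq F" and "\<And>x. (\<lambda>n. F n x) \<longlonglongrightarrow> f x"
  shows "F \<longlonglongrightarrow> f"
proof (rule uniform_limit_tendsto_bcontfun, rule uniform_limitI)
  fix e :: real assume e: "0 < e"
  define U where "U n = {x. F n x < f x + e}" for n
  have mono: "F m x \<le> F n x" if "n \<le> m" for n m x
    using decseqD[OF assms(2) that] by (auto simp: less_eq_bcontfun_def)
  have ge: "f x \<le> F n x" for n x
    by (rule LIMSEQ_le_const2[OF assms(3)[of x]]) (use mono in auto)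
  have "open (U n)" for n
    unfolding U_def by (intro open_Collect_less continuous_intros continuous_on_apply_bcontfun)
  moreover have "UNIV \<subseteq> (\<Union>n\<in>UNIV. U n)"
  proof
    fix x
    have "\<forall>\<^sub>F n in sequentially. F n x < f x + e"
      by (rule order_tendstoD[OF assms(3)]) (use e in simp)
    then show "x \<in> (\<Union>n\<in>UNIV. U n)"
      by (auto simp: U_def eventually_sequentially)
  qed
  ultimately obtain N where N: "finite N" "UNIV \<subseteq> (\<Union>n\<in>N. U n)"
    using compactE_image[OF assms(1), of UNIV U] by metis
  \<comment> \<open>Each point lies in some \<open>U k\<close> of the finite subcover, and passing
    to a later \<open>n\<close> only lowers \<open>F n x\<close>.\<close>
  have "\<forall>x. dist (F n x) (f x) < e" if "n \<ge> Max N" for n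
  proof
    fix x
    obtain k where k: "k \<in> N" "F k x < f x + e"
      using N(2) by (auto simp: U_def)
    then have "F n x \<le> F k x"
      using mono N(1) that by (meson Max_ge order_trans)
    then show "dist (F n x) (f x) < e"
      using k ge[of x n] by (simp add: dist_real_def)
  qed
  then show "\<forall>\<^sub>F n in sequentially. \<forall>x\<in>UNIV. dist (F n x) (f x) < e"
    by (auto simp: eventually_sequentially)
qed

text \<open>Since \<open>f\<close> lies below \<open>g\<close> plus the constant
  \<open>norm (f - g)\<close>, the two properties of \<open>J\<close> bound \<open>J f - J g\<close>
  by a multiple of \<open>J\<close> at 1. Exchanging \<open>f\<close> and \<open>g\<close> gives a
  Lipschitz estimate in norm, to be used with Dini's theorem.\<close>

lemma upper_continuous_if_mono_translation_invariant:
  fixes J :: "('x::topological_space \<Rightarrow>\<^sub>C real) \<Rightarrow> 'e::banach_lattice"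
  assumes "compact (UNIV :: 'x set)" and "mono J" and "translation_invariant J"
  shows "upper_continuous J"
proof -
  let ?e = "J (const_bcontfun 1)"
  have le: "J f - J g \<le> norm (f - g) *\<^sub>R ?e" for f g
  proof -
    have "f x \<le> g x + norm (f - g)" for x
      using norm_bounded[of "f - g" x] by simp
    then have "f \<le> g + norm (f - g) *\<^sub>R const_bcontfun 1"
      by (simp add: less_eq_bcontfun_def)
    then have "J f \<le> J (g + norm (f - g) *\<^sub>R const_bcontfun 1)"
      using \<open>mono J\<close> by (simp add: monoD)
    then show ?thesis
      using assms(3) by (simp add: translation_invariant_def algebra_simps)
  qed
  have lip: "norm (J f - J g) \<le> norm (f - g) * norm ?e" for f g
  proof -
    have "\<bar>J f - J g\<bar> \<le> norm (f - g) *\<^sub>R ?e"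
      using le[of f g] le[of g f] by (intro abs_leI) (auto simp: norm_minus_commute)
    \<comment> \<open>\<open>norm_mono_abs\<close> compares two moduli, so the upper bound is
      replaced by its own modulus.\<close>
    also have "\<dots> \<le> \<bar>norm (f - g) *\<^sub>R ?e\<bar>"
      by (rule abs_ge_self)
    finally have "norm (J f - J g) \<le> norm (norm (f - g) *\<^sub>R ?e)"
      by (rule norm_mono_abs)
    then show ?thesis by simp
  qed
  show ?thesis
    unfolding upper_continuous_def
  proof (intro allI impI, elim conjE)
    fix F :: "nat \<Rightarrow> 'x \<Rightarrow>\<^sub>C real" and f :: "'x \<Rightarrow>\<^sub>C real"
    assume "decseq F" "\<forall>x. (\<lambda>n. F n x) \<longlonglongrightarrow> f x"
    then have "(F \<longlongrightarrow> f) sequentially"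
      using Dini_bcontfun[OF assms(1)] by blast
    then have "(\<lambda>n. norm (F n - f) * norm ?e) \<longlonglongrightarrow> 0"
      by (auto intro!: tendsto_mult_left_zero simp: LIM_zero_iff tendsto_norm_zero_iff)
    then show "(\<lambda>n. norm (J (F n) - J f)) \<longlonglongrightarrow> 0"
      by (rule Lim_null_comparison[rotated]) (use lip in auto)
  qed
qed

section \<open>Scaling of the modulus and concatenation of chains\<close>

text \<open>One inequality holds for every positive factor because scaling preserves the order; the
  reverse one is the same inequality for \<open>inverse b\<close> and
  \<open>b *\<^sub>R x\<close>.\<close>

lemma abs_scaleR_pos:
  fixes x :: "'e::banach_lattice"
  assumes "0 < b"
  shows "\<bar>b *\<^sub>R x\<bar> = b *\<^sub>R \<bar>x\<bar>"
proof -
  have le: "\<bar>c *\<^sub>R y\<bar> \<le> c *\<^sub>R \<bar>y\<bar>" if "0 < c" for c and y :: 'e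
  proof (rule abs_leI)
    show "c *\<^sub>R y \<le> c *\<^sub>R \<bar>y\<bar>"
      using that by (intro scaleR_left_mono abs_ge_self) simp
    have "c *\<^sub>R (- y) \<le> c *\<^sub>R \<bar>y\<bar>"
      using that by (intro scaleR_left_mono abs_ge_minus_self) simp
    then show "- (c *\<^sub>R y) \<le> c *\<^sub>R \<bar>y\<bar>" by simp
  qed
  have "b *\<^sub>R \<bar>inverse b *\<^sub>R (b *\<^sub>R x)\<bar> \<le> b *\<^sub>R (inverse b *\<^sub>R \<bar>b *\<^sub>R x\<bar>)"
    using assms by (intro scaleR_left_mono le) auto
  then show ?thesis
    using le[OF assms, of x] assms by (intro order_antisym) auto
qed

lemma variation_sumsI:
  fixes F :: "nat \<Rightarrow> ('x::topological_space \<Rightarrow>\<^sub>C real)"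
  assumes "F 0 = f" "F n = g" "\<And>k. k \<in> {1..n} \<Longrightarrow> F (k - 1) \<le> F k"
  shows "(\<Sum>k = 1..n. \<bar>I (F k) - I (F (k - 1))\<bar>) \<in> variation_sums I f g"
  using assms unfolding variation_sums_def by blast

lemma variation_sumsE:
  assumes "a \<in> variation_sums I f g"
  obtains F and n :: nat where "a = (\<Sum>k = 1..n. \<bar>I (F k) - I (F (k - 1))\<bar>)"
    "F 0 = f" "F n = g" "\<And>k. k \<in> {1..n} \<Longrightarrow> F (k - 1) \<le> F k"
  using assms unfolding variation_sums_def by blast

text \<open>Running through one chain and then the other gives a chain whose sum is the total of
  both.\<close>

lemma variation_sums_add:
  assumes "a \<in> variation_sums I f g" and "b \<in> variation_sums I g h"
  shows "a + b \<in> variation_sums I f h"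
proof -
  obtain F and n :: nat where F: "a = (\<Sum>k = 1..n. \<bar>I (F k) - I (F (k - 1))\<bar>)"
    "F 0 = f" "F n = g" "\<And>k. k \<in> {1..n} \<Longrightarrow> F (k - 1) \<le> F k"
    using assms(1) by (rule variation_sumsE) blast
  obtain G and m :: nat where G: "b = (\<Sum>k = 1..m. \<bar>I (G k) - I (G (k - 1))\<bar>)"
    "G 0 = g" "G m = h" "\<And>k. k \<in> {1..m} \<Longrightarrow> G (k - 1) \<le> G k"
    using assms(2) by (rule variation_sumsE) blast
  \<comment> \<open>The branches agree at the junction \<open>k = n\<close>, as
    \<open>F n = g = G 0\<close>; hence \<open>H (k + n) = G k\<close> holds for
    \<open>k = 0\<close> too.\<close>
  define H where "H k = (if k \<le> n then F k else G (k - n))" for k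
  have H: "H (k + n) = G k" for k
    using F(3) G(2) by (simp add: H_def)
  have "(\<Sum>k = 1..n + m. \<bar>I (H k) - I (H (k - 1))\<bar>)
      = (\<Sum>k = 1..n. \<bar>I (H k) - I (H (k - 1))\<bar>) + (\<Sum>k = n + 1..n + m. \<bar>I (H k) - I (H (k - 1))\<bar>)"
    by (rule sum.ub_add_nat) simp
  also have "(\<Sum>k = 1..n. \<bar>I (H k) - I (H (k - 1))\<bar>) = a"
    unfolding F(1) by (rule sum.cong) (auto simp: H_def)
  also have "(\<Sum>k = n + 1..n + m. \<bar>I (H k) - I (H (k - 1))\<bar>)
      = (\<Sum>k = 1..m. \<bar>I (H (k + n)) - I (H (k + n - 1))\<bar>)"
    using sum.shift_bounds_cl_nat_ivl[of "\<lambda>k. \<bar>I (H k) - I (H (k - 1))\<bar>" 1 n m]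
    by (simp add: add.commute)
  also have "\<dots> = b"
    unfolding G(1)
  proof (rule sum.cong)
    fix k assume "k \<in> {1..m}"
    \<comment> \<open>Subtraction on naturals is truncated; the equation relies on \<open>k\<close>
      being at least 1.\<close>
    then have "k + n - 1 = (k - 1) + n" by auto
    then show "\<bar>I (H (k + n)) - I (H (k + n - 1))\<bar> = \<bar>I (G k) - I (G (k - 1))\<bar>"
      by (simp only: H)
  qed simp
  finally have sum: "(\<Sum>k = 1..n + m. \<bar>I (H k) - I (H (k - 1))\<bar>) = a + b" .
  have "H (k - 1) \<le> H k" if k: "k \<in> {1..n + m}" for k
  proof (cases "k \<le> n")
    case True
    then show ?thesis using F(4)[of k] k by (auto simp: H_def)
  next
    case False
    then have "k - n \<in> {1..m}" "k = (k - n) + n" "k - 1 = (k - n - 1) + n"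
      using k by auto
    then show ?thesis using G(4)[of "k - n"] H by metis
  qed
  moreover have "H 0 = f" "H (n + m) = h"
    using F(2) G(3) H[of m] by (auto simp: H_def add.commute)
  ultimately show ?thesis
    using variation_sumsI[of H f "n + m" h I] unfolding sum by blast
qed

lemma abs_diff_in_variation_sums:
  assumes "f \<le> g"
  shows "\<bar>I g - I f\<bar> \<in> variation_sums I f g"
  using variation_sumsI[of "\<lambda>k. if k = 0 then f else g" f 1 g I] assms by simp

section \<open>Total variation of a comonotonic additive operator\<close>

locale comonotonic_bv =
  fixes I :: "('x::topological_space \<Rightarrow>\<^sub>C real) \<Rightarrow> 'e::banach_lattice"
  assumes additive: "comonotonic_additive I" and bv: "bounded_variation I"
begin

lemma add_comonotone: "comonotone f g \<Longrightarrow> I (f + g) = I f + I g"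
  using additive by (simp add: comonotonic_additive_def)

lemma add_const: "I (f + const_bcontfun c) = I f + I (const_bcontfun c)"
  by (intro add_comonotone comonotone_const)

lemma I_zero: "I 0 = 0"
  using add_comonotone[of 0 0] by (simp add: comonotone_def)

text \<open>Bounded variation guarantees the least upper bound only for \<open>0 \<le> f\<close>;
  elsewhere the chosen value is arbitrary, which is why \<open>variation_part\<close> shifts its
  argument first.\<close>

definition variation :: "('x \<Rightarrow>\<^sub>C real) \<Rightarrow> 'e" where
  "variation f = (SOME s. isLub UNIV (variation_sums I 0 f) s)"

lemma isLub_variation: "0 \<le> f \<Longrightarrow> isLub UNIV (variation_sums I 0 f) (variation f)"
  using bv unfolding variation_def bounded_variation_def by (blast intro: someI_ex)

lemma variation_upper: "0 \<le> f \<Longrightarrow> a \<in> variation_sums I 0 f \<Longrightarrow> a \<le> variation f"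
  by (rule isLubD2[OF isLub_variation])

lemma variation_least:
  "0 \<le> f \<Longrightarrow> (\<And>a. a \<in> variation_sums I 0 f \<Longrightarrow> a \<le> s) \<Longrightarrow> variation f \<le> s"
  by (blast intro: isLub_le_isUb[OF isLub_variation] isUb_UNIV_I)

lemma variation_chain:
  fixes F :: "nat \<Rightarrow> ('x \<Rightarrow>\<^sub>C real)"
  assumes "F 0 = 0" "F n = f" "\<And>k. k \<in> {1..n} \<Longrightarrow> F (k - 1) \<le> F k" "0 \<le> f"
  shows "(\<Sum>k = 1..n. \<bar>I (F k) - I (F (k - 1))\<bar>) \<le> variation f"
  using assms by (intro variation_upper variation_sumsI)

text \<open>A chain ending at \<open>f\<close> can be prolonged by the single step from
  \<open>f\<close> to \<open>g\<close>. The monotonicity of both final operators rests on this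
  estimate.\<close>

lemma variation_increment:
  assumes "0 \<le> f" "f \<le> g"
  shows "variation f + \<bar>I g - I f\<bar> \<le> variation g"
proof -
  have "variation f \<le> variation g - \<bar>I g - I f\<bar>"
  proof (rule variation_least[OF assms(1)])
    fix a assume "a \<in> variation_sums I 0 f"
    then have "a + \<bar>I g - I f\<bar> \<in> variation_sums I 0 g"
      by (rule variation_sums_add[OF _ abs_diff_in_variation_sums[OF assms(2)]])
    then show "a \<le> variation g - \<bar>I g - I f\<bar>"
      using variation_upper[OF order_trans[OF assms]] by (simp add: le_diff_eq)
  qed
  then show ?thesis by (simp add: le_diff_eq)
qed

lemma variation_mono: "0 \<le> f \<Longrightarrow> f \<le> g \<Longrightarrow> variation f \<le> variation g"
  by (metis variation_increment abs_ge_zero add_increasing2 order_refl order_trans)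

text \<open>Raising a chain by a constant changes all values of \<open>I\<close> by the same vector,
  so the increments stay the same.\<close>

lemma variation_sums_add_const:
  assumes "a \<in> variation_sums I f g"
  shows "a \<in> variation_sums I (f + const_bcontfun c) (g + const_bcontfun c)"
proof -
  obtain F and n :: nat where F: "a = (\<Sum>k = 1..n. \<bar>I (F k) - I (F (k - 1))\<bar>)"
    "F 0 = f" "F n = g" "\<And>k. k \<in> {1..n} \<Longrightarrow> F (k - 1) \<le> F k"
    using assms by (rule variation_sumsE) blast
  let ?G = "\<lambda>k. F k + const_bcontfun c"
  have "a = (\<Sum>k = 1..n. \<bar>I (?G k) - I (?G (k - 1))\<bar>)"
    by (simp add: F(1) add_const)
  also have "\<dots> \<in> variation_sums I (f + const_bcontfun c) (g + const_bcontfun c)"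
    by (rule variation_sumsI) (use F(2-4) in \<open>auto simp: less_eq_bcontfun_def\<close>)
  finally show ?thesis .
qed

text \<open>For the upper bound, each chain is cut at height \<open>c\<close>. For the lower bound,
  a chain from 0 to \<open>c\<close> is continued by a chain from 0 to \<open>f\<close> raised by
  \<open>c\<close>.\<close>

lemma variation_add_const:
  assumes f: "0 \<le> f" and c: "0 \<le> c"
  shows "variation (f + const_bcontfun c) = variation f + variation (const_bcontfun c)"
proof (rule order_antisym)
  let ?c = "const_bcontfun c :: 'x \<Rightarrow>\<^sub>C real"
  have c0: "0 \<le> ?c" and fc0: "0 \<le> f + ?c"
    using f c by (auto simp: less_eq_bcontfun_def)
  show "variation (f + ?c) \<le> variation f + variation ?c"
  proof (rule variation_least[OF fc0])
    fix a assume "a \<in> variation_sums I 0 (f + ?c)"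
    then obtain F and n :: nat where F: "a = (\<Sum>k = 1..n. \<bar>I (F k) - I (F (k - 1))\<bar>)"
      "F 0 = 0" "F n = f + ?c" "\<And>k. k \<in> {1..n} \<Longrightarrow> F (k - 1) \<le> F k"
      by (rule variation_sumsE) blast
    \<comment> \<open>As \<open>f\<close> and \<open>c\<close> are nonnegative, the truncations
      \<open>G\<close> climb from 0 to \<open>c\<close> and the remainders \<open>H\<close> from 0
      to \<open>f\<close>.\<close>
    define G where "G k = min_bcontfun (F k) c" for k
    define H where "H k = F k - G k" for k
    have split: "I (F k) = I (G k) + I (H k)" for k
      using add_comonotone[OF comonotone_min_bcontfun, of "F k" c] by (simp add: G_def H_def)
    have "a \<le> (\<Sum>k = 1..n. \<bar>I (G k) - I (G (k - 1))\<bar> + \<bar>I (H k) - I (H (k - 1))\<bar>)"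
      unfolding F(1) by (intro sum_mono) (simp add: split add_diff_add abs_triangle_ineq)
    also have "\<dots> = (\<Sum>k = 1..n. \<bar>I (G k) - I (G (k - 1))\<bar>)
        + (\<Sum>k = 1..n. \<bar>I (H k) - I (H (k - 1))\<bar>)"
      by (rule sum.distrib)
    also have "\<dots> \<le> variation ?c + variation f"
    proof (intro add_mono variation_chain c0 f)
      show G0: "G 0 = 0" and Gn: "G n = ?c"
        using f c by (auto intro!: bcontfun_eqI
            simp: G_def F(2,3) apply_min_bcontfun less_eq_bcontfun_def)
      show "H 0 = 0" "H n = f"
        by (simp_all add: H_def G0 Gn F(2,3))
      show "G (k - 1) \<le> G k" "H (k - 1) \<le> H k" if "k \<in> {1..n}" for k
      proof -
        have *: "F (k - 1) x \<le> F k x" for x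
          using F(4)[OF that] by (simp add: less_eq_bcontfun_def)
        show "G (k - 1) \<le> G k"
          unfolding less_eq_bcontfun_def G_def apply_min_bcontfun using * by (meson min.mono order_refl)
        have "F (k - 1) x - min (F (k - 1) x) c \<le> F k x - min (F k x) c" for x
          using *[of x] by linarith
        then show "H (k - 1) \<le> H k"
          by (simp add: less_eq_bcontfun_def G_def H_def apply_min_bcontfun)
      qed
    qed
    finally show "a \<le> variation f + variation ?c"
      by (simp add: add.commute)
  qed
  have "variation f \<le> variation (f + ?c) - variation ?c"
  proof (rule variation_least[OF f])
    fix b assume "b \<in> variation_sums I 0 f"
    then have b: "b \<in> variation_sums I ?c (f + ?c)"
      using variation_sums_add_const[of b 0 f c] by simp
    \<comment> \<open>The two suprema are taken one after the other: first over chains from 0 to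
      \<open>c\<close> with \<open>b\<close> fixed, then over \<open>b\<close>.\<close>
    have "variation ?c \<le> variation (f + ?c) - b"
      by (rule variation_least[OF c0])
        (use variation_sums_add[OF _ b] variation_upper[OF fc0] in \<open>simp add: le_diff_eq\<close>)
    then show "b \<le> variation (f + ?c) - variation ?c"
      by (simp add: algebra_simps)
  qed
  then show "variation f + variation ?c \<le> variation (f + ?c)"
    by (simp add: le_diff_eq)
qed

section \<open>Homogeneity of the operator and of its variation\<close>

text \<open>Along the ray of \<open>f\<close> the operator solves Cauchy's functional equation, and
  bounded variation keeps the solution bounded on the unit interval, which forces linearity.\<close>

lemma I_scaleR_nonneg:
  assumes f: "0 \<le> f" and a: "0 \<le> a"
  shows "I (a *\<^sub>R f) = a *\<^sub>R I f"
proof -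
  define \<phi> where "\<phi> t = I (t *\<^sub>R f)" for t
  have add: "\<phi> (s + t) = \<phi> s + \<phi> t" if "0 \<le> s" "0 \<le> t" for s t
    using add_comonotone[OF comonotone_scaleR[OF that, of f]] by (simp add: \<phi>_def scaleR_add_left)
  have mult: "\<phi> (real n * t) = real n *\<^sub>R \<phi> t" if "0 \<le> t" for n t
  proof (induction n)
    case 0
    then show ?case by (simp add: \<phi>_def I_zero)
  next
    case (Suc n)
    then show ?case
      using add[of "real n * t" t] that by (simp add: algebra_simps)
  qed
  have bound: "norm (\<phi> t) \<le> norm (variation f)" if t: "0 \<le> t" "t \<le> 1" for t
  proof (rule norm_mono_abs)
    have tf: "0 \<le> t *\<^sub>R f" "t *\<^sub>R f \<le> f"
      using t f by (auto simp: less_eq_bcontfun_def mult_left_le_one_le)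
    \<comment> \<open>The chain with the single step from 0 to 0 has sum 0.\<close>
    have "0 \<le> variation 0"
      using variation_upper[of 0 0] abs_diff_in_variation_sums[of 0 0 I] by simp
    then have "\<bar>\<phi> t\<bar> \<le> variation 0 + \<bar>I (t *\<^sub>R f) - I 0\<bar>"
      by (simp add: \<phi>_def I_zero)
    also have "\<dots> \<le> variation (t *\<^sub>R f)"
      by (rule variation_increment) (use tf in auto)
    also have "\<dots> \<le> variation f"
      using tf by (rule variation_mono)
    also have "\<dots> \<le> \<bar>variation f\<bar>"
      by (rule abs_ge_self)
    finally show "\<bar>\<phi> t\<bar> \<le> \<bar>variation f\<bar>" .
  qed
  \<comment> \<open>With \<open>n a = m + r\<close>, \<open>m = \<lfloor>n a\<rfloor>\<close>, additivity turns the defect \<open>\<phi> a - a \<phi> 1\<close>, multiplied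
    by \<open>n\<close>, into \<open>\<phi> r - r \<phi> 1\<close>, which is bounded.\<close>
  have "real n * norm (\<phi> a - a *\<^sub>R \<phi> 1) \<le> 2 * norm (variation f)" for n
  proof -
    define m where "m = nat \<lfloor>real n * a\<rfloor>"
    define r where "r = real n * a - real m"
    have m: "real m = of_int \<lfloor>real n * a\<rfloor>"
      using a by (simp add: m_def)
    have r: "0 \<le> r" "r \<le> 1"
      unfolding r_def m by linarith+
    have na: "real n * a = real m * 1 + r"
      by (simp add: r_def)
    have "real n *\<^sub>R \<phi> a = \<phi> (real m * 1 + r)"
      using mult[OF a, of n] by (simp add: na)
    also have "\<dots> = real m *\<^sub>R \<phi> 1 + \<phi> r"
      using add[of "real m * 1" r] mult[of 1 m] r by simp
    finally have "real n *\<^sub>R (\<phi> a - a *\<^sub>R \<phi> 1) = \<phi> r - r *\<^sub>R \<phi> 1"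
      by (simp add: r_def algebra_simps)
    then have "real n * norm (\<phi> a - a *\<^sub>R \<phi> 1) = norm (\<phi> r - r *\<^sub>R \<phi> 1)"
      by (metis norm_scaleR abs_of_nat)
    also have "\<dots> \<le> norm (\<phi> r) + r * norm (\<phi> 1)"
      using norm_triangle_ineq4[of "\<phi> r" "r *\<^sub>R \<phi> 1"] r by simp
    also have "\<dots> \<le> norm (variation f) + 1 * norm (variation f)"
      by (intro add_mono mult_mono bound) (use r in auto)
    finally show ?thesis by simp
  qed
  \<comment> \<open>All multiples of this norm stay below a fixed bound, so by the Archimedean
    property it vanishes.\<close>
  then have "norm (\<phi> a - a *\<^sub>R \<phi> 1) = 0"
    by (metis norm_ge_zero reals_Archimedean3 less_le not_le)
  then show ?thesis by (simp add: \<phi>_def)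
qed

text \<open>Adding the constant \<open>norm f\<close> reduces to nonnegative functions; the
  contribution of the constant then cancels.\<close>

lemma I_scaleR:
  assumes a: "0 \<le> a"
  shows "I (a *\<^sub>R f) = a *\<^sub>R I f"
proof -
  let ?c = "const_bcontfun (norm f) :: 'x \<Rightarrow>\<^sub>C real"
  have c: "0 \<le> ?c"
    by (simp add: less_eq_bcontfun_def)
  have ac: "a *\<^sub>R ?c = const_bcontfun (a * norm f)"
    by (rule bcontfun_eqI) simp
  have "I (a *\<^sub>R f) + I (a *\<^sub>R ?c) = I (a *\<^sub>R (f + ?c))"
    by (simp add: ac add_const scaleR_add_right)
  also have "\<dots> = a *\<^sub>R I f + a *\<^sub>R I ?c"
    using I_scaleR_nonneg[OF add_const_norm_nonneg[OF order_refl] a, of f]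
    by (simp add: add_const scaleR_add_right)
  also have "a *\<^sub>R I ?c = I (a *\<^sub>R ?c)"
    by (rule I_scaleR_nonneg[OF c a, symmetric])
  finally show ?thesis by simp
qed

text \<open>For negative \<open>c\<close>, the constants \<open>c\<close> and \<open>- c\<close> sum
  to 0, so additivity reduces the claim to homogeneity with factor \<open>- c\<close>.\<close>

lemma I_const: "I (const_bcontfun c) = c *\<^sub>R I (const_bcontfun 1)"
proof (cases "0 \<le> c")
  case True
  then show ?thesis
    using I_scaleR[of c "const_bcontfun 1"] by (simp add: scaleR_const_bcontfun_one)
next
  case False
  then have "I (const_bcontfun (- c)) = (- c) *\<^sub>R I (const_bcontfun 1)"
    using I_scaleR[of "- c" "const_bcontfun 1"] unfolding scaleR_const_bcontfun_one by simp
  moreover have "const_bcontfun (- c) + const_bcontfun c = (0 :: 'x \<Rightarrow>\<^sub>C real)"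
    by (rule bcontfun_eqI) simp
  then have "I (const_bcontfun (- c)) + I (const_bcontfun c) = 0"
    using add_const[of "const_bcontfun (- c)" c] I_zero by simp
  ultimately show ?thesis by simp
qed

text \<open>Scaling a chain to \<open>b *\<^sub>R g\<close> by \<open>inverse b\<close> gives a
  chain to \<open>g\<close>, whence one inequality for all positive factors. Applying it again with
  the inverse factor gives equality.\<close>

lemma variation_scaleR:
  assumes f: "0 \<le> f" and a: "0 < a"
  shows "variation (a *\<^sub>R f) = a *\<^sub>R variation f"
proof -
  have le: "variation (b *\<^sub>R g) \<le> b *\<^sub>R variation g" if g: "0 \<le> g" and b: "0 < b" for b g
  proof (rule variation_least)
    show "0 \<le> b *\<^sub>R g"
      using g b by (simp add: less_eq_bcontfun_def)
    fix s assume "s \<in> variation_sums I 0 (b *\<^sub>R g)"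
    then obtain F and n :: nat where F: "s = (\<Sum>k = 1..n. \<bar>I (F k) - I (F (k - 1))\<bar>)"
      "F 0 = 0" "F n = b *\<^sub>R g" "\<And>k. k \<in> {1..n} \<Longrightarrow> F (k - 1) \<le> F k"
      by (rule variation_sumsE) blast
    define G where "G k = inverse b *\<^sub>R F k" for k
    have "(\<Sum>k = 1..n. \<bar>I (G k) - I (G (k - 1))\<bar>) \<le> variation g"
      by (rule variation_chain)
        (use F(2-4) g b in \<open>auto simp: G_def less_eq_bcontfun_def\<close>)
    then have "b *\<^sub>R (\<Sum>k = 1..n. \<bar>I (G k) - I (G (k - 1))\<bar>) \<le> b *\<^sub>R variation g"
      using b by (simp add: scaleR_left_mono)
    moreover have "b *\<^sub>R \<bar>I (G k) - I (G (k - 1))\<bar> = \<bar>I (F k) - I (F (k - 1))\<bar>" for k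
    proof -
      have "I (G j) = inverse b *\<^sub>R I (F j)" for j
        using b by (simp add: G_def I_scaleR)
      then have "b *\<^sub>R (I (G k) - I (G (k - 1))) = I (F k) - I (F (k - 1))"
        using b by (simp add: scaleR_diff_right)
      then show ?thesis
        using abs_scaleR_pos[OF b] by metis
    qed
    ultimately show "s \<le> b *\<^sub>R variation g"
      by (simp add: F(1) scaleR_sum_right)
  qed
  have "variation f \<le> inverse a *\<^sub>R variation (a *\<^sub>R f)"
    using le[of "a *\<^sub>R f" "inverse a"] f a by (simp add: less_eq_bcontfun_def)
  then have "a *\<^sub>R variation f \<le> a *\<^sub>R (inverse a *\<^sub>R variation (a *\<^sub>R f))"
    using a by (intro scaleR_left_mono) auto
  then show ?thesis
    using le[OF f a] a by (intro order_antisym) auto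
qed

section \<open>Extension of the variation to all of \<open>C(X)\<close>\<close>

text \<open>This is \<open>I\<^sub>1\<close>. The shift by \<open>norm f\<close> is one convenient
  choice, and \<open>variation_part_eq\<close> shows that the value does not depend on it.\<close>

definition variation_part :: "('x \<Rightarrow>\<^sub>C real) \<Rightarrow> 'e" where
  "variation_part f = variation (f + const_bcontfun (norm f)) - variation (const_bcontfun (norm f))"

text \<open>The variation of \<open>f\<close> raised by \<open>c + norm f\<close> is expanded twice,
  splitting off either constant.\<close>

lemma variation_part_eq:
  assumes "0 \<le> c" "0 \<le> f + const_bcontfun c"
  shows "variation_part f = variation (f + const_bcontfun c) - variation (const_bcontfun c)"
proof -
  have *: "const_bcontfun s + const_bcontfun t = (const_bcontfun (s + t) :: 'x \<Rightarrow>\<^sub>C real)" for s t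
    by (rule bcontfun_eqI) simp
  have **: "variation (f + const_bcontfun (s + t)) = variation (f + const_bcontfun s) + variation (const_bcontfun t)"
    if "0 \<le> f + const_bcontfun s" "0 \<le> t" for s t
    using variation_add_const[OF that] by (simp add: * add.assoc)
  show ?thesis
    using **[OF assms(2), of "norm f"] **[OF add_const_norm_nonneg[OF order_refl] assms(1)]
    by (simp add: variation_part_def algebra_simps)
qed

lemma variation_const:
  assumes "0 \<le> c"
  shows "variation (const_bcontfun c) = c *\<^sub>R variation (const_bcontfun 1)"
proof (cases "c = 0")
  case True
  have "const_bcontfun 0 = (0 :: 'x \<Rightarrow>\<^sub>C real)"
    by (rule bcontfun_eqI) simp
  \<comment> \<open>Additivity with both arguments zero makes the variation at 0 equal to twice
    itself.\<close>
  then show ?thesis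
    using True variation_add_const[of 0 0] by simp
next
  case False
  then show ?thesis
    using variation_scaleR[of "const_bcontfun 1" c] assms
    by (simp add: less_eq_bcontfun_def scaleR_const_bcontfun_one)
qed

lemma translation_invariant_variation_part: "translation_invariant variation_part"
proof -
  let ?v = "variation (const_bcontfun 1)"
  have shift: "variation_part (f + const_bcontfun c) = variation_part f + c *\<^sub>R ?v" for f c
  proof -
    \<comment> \<open>With this \<open>d\<close>, shifting \<open>f\<close> by \<open>c + d\<close>
      and shifting \<open>f\<close> raised by \<open>c\<close> by \<open>d\<close> give the same
      nonnegative function.\<close>
    define d where "d = norm f + \<bar>c\<bar>"
    have eq: "f + const_bcontfun c + const_bcontfun d = f + const_bcontfun (c + d)"
      by (rule bcontfun_eqI) simp
    have "norm f \<le> c + d" and d: "0 \<le> d"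
      by (auto simp: d_def)
    then have cd: "0 \<le> c + d" and f: "0 \<le> f + const_bcontfun (c + d)"
      using norm_ge_zero[of f] by (linarith, intro add_const_norm_nonneg)
    have "variation_part (f + const_bcontfun c)
        = variation (f + const_bcontfun (c + d)) - d *\<^sub>R ?v"
      using variation_part_eq[OF d, of "f + const_bcontfun c"] f by (simp add: eq variation_const[OF d])
    moreover have "variation_part f = variation (f + const_bcontfun (c + d)) - (c + d) *\<^sub>R ?v"
      using variation_part_eq[OF cd f] by (simp add: variation_const[OF cd])
    ultimately show ?thesis by (simp only:) (simp add: algebra_simps)
  qed
  have "variation_part 0 = 0"
    by (simp add: variation_part_def)
  then have "variation_part (const_bcontfun 1) = ?v"
    using shift[of 0 1] by simp
  then show ?thesis
    by (simp add: translation_invariant_def scaleR_const_bcontfun_one shift)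
qed

lemma positively_homogeneous_variation_part: "positively_homogeneous variation_part"
  unfolding positively_homogeneous_def
proof (intro allI impI)
  fix f and a :: real assume "0 \<le> a"
  show "variation_part (a *\<^sub>R f) = a *\<^sub>R variation_part f"
  proof (cases "a = 0")
    case True
    then show ?thesis by (simp add: variation_part_def)
  next
    case False
    with \<open>0 \<le> a\<close> have a: "0 < a" by simp
    \<comment> \<open>The norm is homogeneous, so the shift scales along with the function.\<close>
    have eq: "a *\<^sub>R f + const_bcontfun (norm (a *\<^sub>R f)) = a *\<^sub>R (f + const_bcontfun (norm f))"
      using a by (intro bcontfun_eqI) (simp add: algebra_simps)
    show ?thesis
      unfolding variation_part_def eq
      using variation_scaleR[OF add_const_norm_nonneg[OF order_refl] a, of f] a
        variation_const[of "norm f"] variation_const[of "norm (a *\<^sub>R f)"]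
      by (simp add: scaleR_diff_right)
  qed
qed

text \<open>One constant makes both functions nonnegative, and such a shift leaves the increment of
  \<open>I\<close> unchanged. Bounding the modulus below by 0 and by \<open>I g - I f\<close> yields
  the monotonicity of \<open>I\<^sub>1\<close> and of \<open>I\<^sub>2\<close>.\<close>

lemma variation_part_increment:
  assumes "f \<le> g"
  shows "\<bar>I g - I f\<bar> \<le> variation_part g - variation_part f"
proof -
  define c where "c = norm f + norm g"
  have c: "0 \<le> c" and f: "0 \<le> f + const_bcontfun c" and g: "0 \<le> g + const_bcontfun c"
    by (auto simp: c_def intro: add_const_norm_nonneg)
  have "f + const_bcontfun c \<le> g + const_bcontfun c"
    using assms by (simp add: less_eq_bcontfun_def)
  from variation_increment[OF f this] show ?thesis
    by (simp add: variation_part_eq[OF c f] variation_part_eq[OF c g] add_const algebra_simps)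
qed

lemma mono_variation_part: "mono variation_part"
proof
  fix f g :: "'x \<Rightarrow>\<^sub>C real" assume "f \<le> g"
  then have "0 \<le> variation_part g - variation_part f"
    by (rule order_trans[OF abs_ge_zero variation_part_increment])
  then show "variation_part f \<le> variation_part g" by simp
qed

lemma mono_variation_part_minus: "mono (\<lambda>f. variation_part f - I f)"
proof
  fix f g :: "'x \<Rightarrow>\<^sub>C real" assume "f \<le> g"
  then have "I g - I f \<le> variation_part g - variation_part f"
    by (rule order_trans[OF abs_ge_self variation_part_increment])
  then show "variation_part f - I f \<le> variation_part g - I g"
    by (simp add: algebra_simps)
qed

lemma positively_homogeneous_variation_part_minus:
  "positively_homogeneous (\<lambda>f. variation_part f - I f)"
  using positively_homogeneous_variation_part
  by (simp add: positively_homogeneous_def I_scaleR scaleR_diff_right)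

lemma translation_invariant_variation_part_minus:
  "translation_invariant (\<lambda>f. variation_part f - I f)"
proof -
  have "variation_part (f + c *\<^sub>R const_bcontfun 1)
      = variation_part f + c *\<^sub>R variation_part (const_bcontfun 1)" for f c
    using translation_invariant_variation_part by (simp only: translation_invariant_def)
  moreover have "I (f + c *\<^sub>R const_bcontfun 1) = I f + c *\<^sub>R I (const_bcontfun 1)" for f c
    unfolding scaleR_const_bcontfun_one add_const by (simp only: I_const[of c])
  ultimately show ?thesis
    unfolding translation_invariant_def by (simp only: scaleR_diff_right) simp
qed

end

theorem lemma12:
  fixes I :: "('x::t2_space \<Rightarrow>\<^sub>C real) \<Rightarrow> 'e::banach_lattice"
  assumes "compact (UNIV :: 'x set)"
    and "order_continuous_norm TYPE('e)"
    and "comonotonic_additive I"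
    and "bounded_variation I"
  shows "(\<exists>I1 I2 :: ('x \<Rightarrow>\<^sub>C real) \<Rightarrow> 'e.
            positively_homogeneous I1 \<and> translation_invariant I1 \<and> mono I1 \<and>
            positively_homogeneous I2 \<and> translation_invariant I2 \<and> mono I2 \<and>
            (\<forall>f. I f = I1 f - I2 f)) \<and>
         (upper_continuous I \<longrightarrow>
          (\<exists>I1 I2 :: ('x \<Rightarrow>\<^sub>C real) \<Rightarrow> 'e.
            positively_homogeneous I1 \<and> translation_invariant I1 \<and> mono I1 \<and> upper_continuous I1 \<and>
            positively_homogeneous I2 \<and> translation_invariant I2 \<and> mono I2 \<and> upper_continuous I2 \<and>
            (\<forall>f. I f = I1 f - I2 f)))"
proof -
  interpret comonotonic_bv I
    using assms by unfold_locales
  let ?I2 = "\<lambda>f. variation_part f - I f"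
  \<comment> \<open>The Lipschitz argument applies to each operator in turn, so one pair of
    witnesses serves both claims.\<close>
  have uc: "upper_continuous variation_part" "upper_continuous ?I2"
    by (rule upper_continuous_if_mono_translation_invariant[OF assms(1)],
        rule mono_variation_part mono_variation_part_minus,
        rule translation_invariant_variation_part translation_invariant_variation_part_minus)+
  have dec: "\<forall>f. I f = variation_part f - ?I2 f"
    by simp
  note props = positively_homogeneous_variation_part translation_invariant_variation_part
    mono_variation_part positively_homogeneous_variation_part_minus
    translation_invariant_variation_part_minus mono_variation_part_minus
  show ?thesis
  proof (intro conjI impI)
    show "\<exists>I1 I2 :: ('x \<Rightarrow>\<^sub>C real) \<Rightarrow> 'e.
        positively_homogeneous I1 \<and> translation_invariant I1 \<and> mono I1 \<and>
        positively_homogeneous I2 \<and> translation_invariant I2 \<and> mono I2 \<and>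
        (\<forall>f. I f = I1 f - I2 f)"
      by (rule exI[of _ variation_part], rule exI[of _ ?I2]) (intro conjI props dec)
    show "\<exists>I1 I2 :: ('x \<Rightarrow>\<^sub>C real) \<Rightarrow> 'e.
        positively_homogeneous I1 \<and> translation_invariant I1 \<and> mono I1 \<and> upper_continuous I1 \<and>
        positively_homogeneous I2 \<and> translation_invariant I2 \<and> mono I2 \<and> upper_continuous I2 \<and>
        (\<forall>f. I f = I1 f - I2 f)"
      by (rule exI[of _ variation_part], rule exI[of _ ?I2]) (intro conjI props uc dec)
  qed
qed

end
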